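(* Let $K=\mathbb{F}_q(t)$ have characteristic at least $5$, let $E:y^2=x^3+Ax+B$ (with $A,B\in K$) be an elliptic curve over $K$, and let $$\phi(x)=\frac{x^4-2Ax^2-8Bx+A^2}{4x^3+4Ax+4B}$$ be the Lattès map satisfying $x([2]P)=\phi(x(P))$. For a non-torsion point $P\in E(K)$ write $x([2^n]P)=\phi^n(x(P))=a_n(t)/b_n(t)$ with $a_n,b_n\in\mathbb{F}_q[t]$ coprime. If $2AB'-3BA'\ne0$, then $$\frac12\liminf_{n\to\infty}\frac{\deg(a_n)}{4^n}\le\hat h_E(P)\le 2\limsup_{n\to\infty}\frac{\deg(a_n)}{4^n}\quad\text{and}\quad\frac12\liminf_{n\to\infty}\frac{\deg(b_n)}{4^n}\le\hat h_E(P)\le 2\limsup_{n\to\infty}\frac{\deg(b_n)}{4^n}.$$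
   Context: $'$ denotes the derivation $d/dt$ on $K$. For $z=u/v\in K$ with $u,v\in\mathbb{F}_q[t]$ coprime, the height is $h(z)=\max\{\deg u,\deg v\}$. The canonical height of $P\in E(K)$ is $\hat h_E(P)=\lim_{n\to\infty}4^{-n}h(x([2^n]P))$ (the Néron–Tate canonical height on $E$). *)

theory Defs
  imports
    Complex_Main
    "HOL-Library.Extended_Real"
    "HOL-Library.Liminf_Limsup"
    "HOL-Computational_Algebra.Computational_Algebra"
    "HOL-Algebra.Group"
begin

text \<open>
  The rational function field \<open>F(t)\<close> is rendered as \<open>'a poly fract\<close>, where \<open>'a\<close> is the
  field of constants \<open>F\<close>.
\<close>

definition fract_deriv :: "'a::field poly fract \<Rightarrow> 'a poly fract" where
  "fract_deriv z =
     (THE w. \<exists>u v. v \<noteq> 0 \<and> z = Fract u v \<and>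
        w = Fract (pderiv u * v - u * pderiv v) (v\<^sup>2))"

lemma fract_deriv_Fract:
  fixes u v :: "'a::field poly"
  assumes "v \<noteq> 0"
  shows "fract_deriv (Fract u v) = Fract (pderiv u * v - u * pderiv v) (v\<^sup>2)"
  unfolding fract_deriv_def
proof (rule the_equality)
  show "\<exists>c d. d \<noteq> 0 \<and> Fract u v = Fract c d \<and>
      Fract (pderiv u * v - u * pderiv v) (v\<^sup>2) = Fract (pderiv c * d - c * pderiv d) (d\<^sup>2)"
    using assms by (intro exI[of _ u] exI[of _ v]) simp
next
  fix w
  assume "\<exists>c d. d \<noteq> 0 \<and> Fract u v = Fract c d \<and>
      w = Fract (pderiv c * d - c * pderiv d) (d\<^sup>2)"
  then obtain c d where d: "d \<noteq> 0" and eq: "u * d = c * v"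
    and w: "w = Fract (pderiv c * d - c * pderiv d) (d\<^sup>2)"
    using assms by (auto simp: eq_fract)
  have eq': "u * pderiv d + d * pderiv u = c * pderiv v + v * pderiv c"
    using arg_cong[OF eq, of pderiv] by (simp add: pderiv_mult)
  have "(pderiv u * v - u * pderiv v) * d\<^sup>2 - (pderiv c * d - c * pderiv d) * v\<^sup>2
      = v * d * ((u * pderiv d + d * pderiv u) - (c * pderiv v + v * pderiv c))
        - (u * d - c * v) * (d * pderiv v + v * pderiv d)"
    by (simp add: algebra_simps power2_eq_square)
  also have "\<dots> = 0"
    using eq eq' by simp
  finally show "w = Fract (pderiv u * v - u * pderiv v) (v\<^sup>2)"
    unfolding w using assms d by (subst eq_fract) auto
qed

text \<open>
  Since \<open>degree 0 = 0\<close>, the element \<open>0 = 0/1\<close> gets height \<open>0\<close>.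
\<close>

definition ratfun_height :: "'a::field poly fract \<Rightarrow> nat" where
  "ratfun_height z =
     (THE d. \<exists>u v. v \<noteq> 0 \<and> coprime u v \<and> z = Fract u v \<and> d = max (degree u) (degree v))"

text \<open>
  The library has this only for \<open>semiring_gcd\<close>, which \<open>'a poly\<close> does not instantiate
  for \<open>'a :: field\<close>.
\<close>

lemma coprime_bezout_field_poly:
  fixes u v :: "'a::field poly"
  assumes "coprime u v"
  shows "\<exists>s t. s * u + t * v = 1"
  using assms
proof (induction v arbitrary: u rule: measure_induct_rule[where f = euclidean_size])
  case (less v u)
  show ?case
  proof (cases "v = 0")
    case True
    with less.prems have "u dvd 1" by simp
    then obtain k where "1 = u * k" by (rule dvdE)
    then have "k * u + 0 * v = 1" by (simp add: mult.commute)
    then show ?thesis by blast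
  next
    case False
    have "coprime v (u mod v)"
    proof (rule coprimeI)
      fix c assume c: "c dvd v" "c dvd u mod v"
      then have "c dvd u" by (simp add: dvd_mod_iff)
      with c(1) less.prems show "is_unit c" by (meson coprime_common_divisor)
    qed
    with less.IH[of "u mod v" v] mod_size_less[OF False]
    obtain s t where st: "s * v + t * (u mod v) = 1" by blast
    have "t * u + (s - t * (u div v)) * v = s * v + t * (u - u div v * v)"
      by (simp add: algebra_simps)
    also have "\<dots> = 1"
      using st by (simp add: minus_div_mult_eq_mod)
    finally show ?thesis by blast
  qed
qed

lemma coprime_dvd_mult_field_poly:
  fixes u v w :: "'a::field poly"
  assumes "coprime u v" "u dvd w * v"
  shows "u dvd w"
proof -
  obtain s t where "s * u + t * v = 1"
    using coprime_bezout_field_poly[OF assms(1)] by blast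
  then have "w = w * (s * u + t * v)" by simp
  also have "\<dots> = u * (w * s) + t * (w * v)"
    by (simp add: algebra_simps)
  finally have w: "w = u * (w * s) + t * (w * v)" .
  have "u dvd u * (w * s) + t * (w * v)"
    by (rule dvd_add[OF dvd_triv_left dvd_mult[OF assms(2)]])
  then show ?thesis
    using w by metis
qed

lemma ratfun_height_Fract:
  fixes u v :: "'a::field poly"
  assumes "v \<noteq> 0" "coprime u v"
  shows "ratfun_height (Fract u v) = max (degree u) (degree v)"
  unfolding ratfun_height_def
proof (rule the_equality)
  show "\<exists>u' v'. v' \<noteq> 0 \<and> coprime u' v' \<and> Fract u v = Fract u' v' \<and>
      max (degree u) (degree v) = max (degree u') (degree v')"
    using assms by (intro exI[of _ u] exI[of _ v]) simp
next
  fix d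
  assume "\<exists>u' v'. v' \<noteq> 0 \<and> coprime u' v' \<and> Fract u v = Fract u' v' \<and>
      d = max (degree u') (degree v')"
  then obtain u' v' where *: "v' \<noteq> 0" "coprime u' v'" "u * v' = u' * v"
    and d: "d = max (degree u') (degree v')"
    using assms by (auto simp: eq_fract)
  have cop: "coprime u v" "coprime v u" "coprime u' v'" "coprime v' u'"
    using assms(2) *(2) by (simp_all add: coprime_commute)
  have "u dvd u' * v" "v' dvd u' * v"
    unfolding *(3)[symmetric] by simp_all
  then have dvd1: "u dvd u'" "v' dvd v"
    using coprime_dvd_mult_field_poly[OF cop(1), of u'] coprime_dvd_mult_field_poly[OF cop(4), of v]
    by (simp_all add: mult.commute)
  have "u' dvd u * v'" "v dvd u * v'"
    unfolding *(3) by simp_all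
  then have dvd2: "u' dvd u" "v dvd v'"
    using coprime_dvd_mult_field_poly[OF cop(3), of u] coprime_dvd_mult_field_poly[OF cop(2), of v']
    by (simp_all add: mult.commute)
  have "degree u = degree u'"
  proof (cases "u = 0")
    case False
    with dvd1(1) dvd2(1) show ?thesis
      by (intro antisym dvd_imp_degree_le) auto
  qed (use dvd1(1) in simp)
  moreover have "degree v = degree v'"
    using dvd1(2) dvd2(2) assms(1) *(1) by (intro antisym dvd_imp_degree_le)
  ultimately show "d = max (degree u) (degree v)"
    using d by simp
qed

datatype 'k ec_point = Infinity | Affine (xcoord: 'k) (ycoord: 'k)

definition ec_points :: "'k::field \<Rightarrow> 'k \<Rightarrow> 'k ec_point set" where
  "ec_points A B = insert Infinity {Affine x y |x y. y\<^sup>2 = x ^ 3 + A * x + B}"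

text \<open>
  The chord-tangent addition on \<open>y\<^sup>2 = x\<^sup>3 + A x + B\<close>.  For points of the curve with equal
  \<open>x\<close>-coordinates and \<open>y1 \<noteq> - y2\<close>, one has \<open>y1 = y2 \<noteq> 0\<close>, so the third equation
  has exactly the tangent case in its \<open>x1 = x2\<close> branch.
\<close>

fun ec_add :: "'k::field \<Rightarrow> 'k ec_point \<Rightarrow> 'k ec_point \<Rightarrow> 'k ec_point" where
  "ec_add A Infinity Q = Q"
| "ec_add A P Infinity = P"
| "ec_add A (Affine x1 y1) (Affine x2 y2) =
     (if x1 = x2 \<and> y1 = - y2 then Infinity
      else let l = (if x1 = x2 then (3 * x1\<^sup>2 + A) / (2 * y1) else (y2 - y1) / (x2 - x1));
               x3 = l\<^sup>2 - x1 - x2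
           in Affine x3 (l * (x1 - x3) - y1))"

text \<open>
  The group \<open>E(K)\<close>.  The multiplication-by-\<open>m\<close> map \<open>[m]P\<close> is \<open>P [^]\<^bsub>ec_group A B\<^esub> m\<close>.
\<close>

definition ec_group :: "'k::field \<Rightarrow> 'k \<Rightarrow> 'k ec_point monoid" where
  "ec_group A B = \<lparr>carrier = ec_points A B, monoid.mult = ec_add A, one = Infinity\<rparr>"

definition ec_torsion :: "'k::field \<Rightarrow> 'k \<Rightarrow> 'k ec_point \<Rightarrow> bool" where
  "ec_torsion A B P \<longleftrightarrow> (\<exists>m::nat. m > 0 \<and> P [^]\<^bsub>ec_group A B\<^esub> m = \<one>\<^bsub>ec_group A B\<^esub>)"

definition lattes :: "'k::field \<Rightarrow> 'k \<Rightarrow> 'k \<Rightarrow> 'k" where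
  "lattes A B x =
     (x ^ 4 - 2 * A * x\<^sup>2 - 8 * B * x + A\<^sup>2) / (4 * x ^ 3 + 4 * A * x + 4 * B)"

text \<open>
  Only meant for points with \<open>[2^n]P \<noteq> \<infinity>\<close> for all \<open>n\<close>, since
  \<open>xcoord Infinity\<close> is unspecified.
\<close>

definition canonical_height ::
    "'a::field poly fract \<Rightarrow> 'a poly fract \<Rightarrow> 'a poly fract ec_point \<Rightarrow> real" where
  "canonical_height A B P =
     lim (\<lambda>n. real (ratfun_height (xcoord (P [^]\<^bsub>ec_group A B\<^esub> (2 ^ n :: nat)))) / 4 ^ n)"

end

theory Submission
  imports Defs
begin

text \<open>
  The points of \<open>E\<close> form a group, so \<open>x([2\<^sup>n]P) = \<phi>\<^sup>n(x(P))\<close>. Writing \<open>h\<^sub>n\<close> for the maximum of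
  \<open>deg a\<^sub>n\<close> and \<open>deg b\<^sub>n\<close>, one has \<open>h\<^sub>n\<^sub>+\<^sub>1 \<le> 4 h\<^sub>n + C\<close>, so that \<open>h\<^sub>n / 4\<^sup>n\<close> plus a multiple
  of \<open>4\<^sup>-\<^sup>n\<close> decreases to the canonical height. It is then enough that \<open>h\<^sub>n\<close> exceeds \<open>deg a\<^sub>n\<close>, and
  likewise \<open>deg b\<^sub>n\<close>, by at most a constant infinitely often. At the place at infinity, \<open>\<phi>\<close>
  preserves the order of any sufficiently large pole, because \<open>\<phi>(x) \<sim> x / 4\<close> there; hence
  \<open>deg a\<^sub>n - deg b\<^sub>n\<close> is bounded above. The Wronskian condition gives \<open>A \<noteq> 0\<close> and \<open>B \<noteq> 0\<close>, so if
  \<open>\<phi>\<^sup>n(x(P))\<close> is very close to \<open>0\<close>, then the next iterate has the size of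
  \<open>\<phi>(0) = A\<^sup>2 / (4 B)\<close>; hence \<open>deg b\<^sub>n - deg a\<^sub>n\<close> is bounded above along infinitely many \<open>n\<close>.
\<close>

section \<open>The group law\<close>

fun ec_neg :: "'k::field ec_point \<Rightarrow> 'k ec_point" where
  "ec_neg Infinity = Infinity"
| "ec_neg (Affine x y) = Affine x (- y)"

lemma ec_neg_neg [simp]: "ec_neg (ec_neg X) = X"
  by (cases X) auto

lemma ec_add_Infinity_right [simp]: "ec_add A X Infinity = X"
  by (cases X) auto

lemma ec_add_eq_Infinity_iff: "ec_add A X Y = Infinity \<longleftrightarrow> X = ec_neg Y"
  by (cases X; cases Y) (auto simp: Let_def)

text \<open>
  The second conjunct is the first one multiplied by \<open>y1 + y2\<close> and divided by \<open>x1 - x2\<close>, using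
  the curve equation. Together they pin down the slope of the chord and that of the tangent alike,
  so that no case distinction between the two is needed in the algebraic identities below.
\<close>

definition ec_slope :: "'k::field \<Rightarrow> 'k \<Rightarrow> 'k \<Rightarrow> 'k \<Rightarrow> 'k \<Rightarrow> 'k \<Rightarrow> bool" where
  "ec_slope A x1 y1 x2 y2 l \<longleftrightarrow>
     y1 - y2 = l * (x1 - x2) \<and> l * (y1 + y2) = x1\<^sup>2 + x1 * x2 + x2\<^sup>2 + A"

lemma ec_slope_commute: "ec_slope A x1 y1 x2 y2 l \<Longrightarrow> ec_slope A x2 y2 x1 y1 l"
  unfolding ec_slope_def by (auto simp: algebra_simps)

lemma ec_slope_neg: "ec_slope A x1 y1 x2 y2 l \<Longrightarrow> ec_slope A x1 (- y1) x2 (- y2) (- l)"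
  unfolding ec_slope_def by (auto simp: algebra_simps)

text \<open>The line through the two given points meets the cubic again in
  \<open>(x3, - y3)\<close>. It is therefore also the line through that point and
  \<open>(x2, y2)\<close>, which is what lets \<open>add_neg_cancel\<close> undo an
  addition.\<close>

lemma ec_slope_third:
  assumes "ec_slope A x1 y1 x2 y2 l"
    and "x3 = l\<^sup>2 - x1 - x2" "y3 = l * (x1 - x3) - y1"
  shows "ec_slope A x3 (- y3) x2 y2 l"
proof -
  have y2: "y2 = y1 - l * (x1 - x2)"
    using assms(1) by (simp add: ec_slope_def algebra_simps)
  have A: "A = l * (y1 + y2) - x1\<^sup>2 - x1 * x2 - x2\<^sup>2"
    using assms(1) by (simp add: ec_slope_def algebra_simps)
  show ?thesis
    unfolding ec_slope_def assms(2,3) A y2 by (intro conjI; algebra)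
qed

text \<open>The slope equations determine \<open>y2\<close> and \<open>A\<close>, and the curve
  equation determines \<open>B\<close>; what remains is a polynomial identity in \<open>x1\<close>,
  \<open>x2\<close>, \<open>y1\<close> and \<open>l\<close>.\<close>

lemma ec_third_on_curve:
  assumes "ec_slope A x1 y1 x2 y2 l" "y1\<^sup>2 = x1 ^ 3 + A * x1 + B"
    and "x3 = l\<^sup>2 - x1 - x2" "y3 = l * (x1 - x3) - y1"
  shows "y3\<^sup>2 = x3 ^ 3 + A * x3 + B"
proof -
  have y2: "y2 = y1 - l * (x1 - x2)"
    using assms(1) by (simp add: ec_slope_def algebra_simps)
  have A: "A = l * (y1 + y2) - x1\<^sup>2 - x1 * x2 - x2\<^sup>2"
    using assms(1) by (simp add: ec_slope_def algebra_simps)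
  have B: "B = y1\<^sup>2 - x1 ^ 3 - A * x1"
    using assms(2) by simp
  show ?thesis
    unfolding assms(3,4) B A y2 by algebra
qed

text \<open>
  Over the complex numbers the slope of the chord through the points with parameters \<open>u\<close> and \<open>v\<close> is
  \<open>\<zeta>(u + v) - \<zeta>(u) - \<zeta>(v)\<close>. Hence the slopes \<open>l, n, m, k\<close> for the pairs \<open>(X, Y)\<close>, \<open>(X + Y, Z)\<close>,
  \<open>(Y, Z)\<close>, \<open>(X, Y + Z)\<close> satisfy the cocycle relation \<open>l + n = m + k\<close>. It is linear in the slopes,
  which keeps the polynomial identities behind associativity small.
\<close>

lemma ec_slope_cocycle:
  fixes x1 :: "'k::field"
  assumes lm: "ec_slope A x1 y1 x2 y2 l" "ec_slope A x2 y2 x3 y3 m"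
    and x4: "x4 = l\<^sup>2 - x1 - x2" and y4: "y4 = l * (x1 - x4) - y1"
    and x5: "x5 = m\<^sup>2 - x2 - x3" and y5: "y5 = m * (x2 - x5) - y2"
    and n: "y4 - y3 = n * (x4 - x3)" "x4 \<noteq> x3"
    and k: "y1 - y5 = k * (x1 - x5)" "x1 \<noteq> x5"
  shows "(m - l) * (n + l) = x3 - x1" "l + n = m + k"
proof -
  have y: "y1 = y2 + l * (x1 - x2)" "y3 = y2 + m * (x3 - x2)"
    using lm by (auto simp: ec_slope_def algebra_simps)
  have "l * (y1 + y2) - (x1\<^sup>2 + x1 * x2 + x2\<^sup>2) = m * (y2 + y3) - (x2\<^sup>2 + x2 * x3 + x3\<^sup>2)"
    using lm by (simp add: ec_slope_def)
  then have rel: "l * (2 * y2 + l * (x1 - x2)) - (x1\<^sup>2 + x1 * x2)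
      = m * (2 * y2 + m * (x3 - x2)) - (x2 * x3 + x3\<^sup>2)"
    unfolding y by (simp add: algebra_simps)
  have "(m - l) * (y4 - y3 + l * (x4 - x3)) = (x3 - x1) * (x4 - x3)"
    unfolding y4 x4 y using rel by algebra
  then have "(m - l) * (n + l) * (x4 - x3) = (x3 - x1) * (x4 - x3)"
    unfolding n by algebra
  then show "(m - l) * (n + l) = x3 - x1"
    using n(2) by simp
  have "(y4 - y3) * (x1 - x5) - (y1 - y5) * (x4 - x3) = (m - l) * (x4 - x3) * (x1 - x5)"
    unfolding y4 x4 y5 x5 y using rel by algebra
  then have "(l + n) * ((x4 - x3) * (x1 - x5)) = (m + k) * ((x4 - x3) * (x1 - x5))"
    unfolding n k by algebra
  then show "l + n = m + k"
    using n(2) k(2) by simp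
qed

text \<open>The two slope equations leave no choice for \<open>l\<close>: the first fixes it when
  \<open>x1\<close> and \<open>x2\<close> differ, the second when the points coincide, since then
  \<open>2 * y1\<close> is invertible.\<close>

lemma ec_add_slope:
  assumes "ec_slope A x1 y1 x2 y2 l" "x1 = x2 \<Longrightarrow> y1 \<noteq> - y2"
    and "(2::'k::field) \<noteq> 0"
  shows "ec_add A (Affine x1 y1) (Affine x2 (y2::'k)) =
    Affine (l\<^sup>2 - x1 - x2) (l * (x1 - (l\<^sup>2 - x1 - x2)) - y1)"
proof -
  have "l = (if x1 = x2 then (3 * x1\<^sup>2 + A) / (2 * y1) else (y2 - y1) / (x2 - x1))"
  proof (cases "x1 = x2")
    case True
    then have "y1 = y2"
      using assms(1) by (simp add: ec_slope_def)
    with True assms(2) have "y1 \<noteq> 0"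
      by auto
    then show ?thesis
      using True \<open>y1 = y2\<close> assms(1,3) by (simp add: ec_slope_def field_simps power2_eq_square)
  next
    case False
    then show ?thesis
      using assms(1) by (simp add: ec_slope_def field_simps)
  qed
  then show ?thesis
    using assms(2) by (auto simp: Let_def)
qed

section \<open>Closure, commutativity and cancellation\<close>

locale elliptic_curve =
  fixes A B :: "'k::field"
  assumes two_neq_0: "(2::'k) \<noteq> 0"
    and disc_neq_0: "4 * A ^ 3 + 27 * B\<^sup>2 \<noteq> 0"
begin

abbreviation add (infixl "\<boxplus>" 65) where "X \<boxplus> Y \<equiv> ec_add A X Y"

lemma Affine_in_iff: "Affine x y \<in> ec_points A B \<longleftrightarrow> y\<^sup>2 = x ^ 3 + A * x + B"
  by (auto simp: ec_points_def)

lemma Infinity_in [simp]: "Infinity \<in> ec_points A B"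
  by (auto simp: ec_points_def)

lemma neg_in [simp]: "X \<in> ec_points A B \<Longrightarrow> ec_neg X \<in> ec_points A B"
  by (cases X) (auto simp: Affine_in_iff)

lemma x_eq_imp:
  assumes "Affine x y \<in> ec_points A B" "Affine x y' \<in> ec_points A B"
  shows "y = y' \<or> y = - y'"
  using assms by (simp add: Affine_in_iff flip: power2_eq_iff)

lemma slope_exists:
  assumes "Affine x1 y1 \<in> ec_points A B" "Affine x2 y2 \<in> ec_points A B"
    and "x1 = x2 \<Longrightarrow> y1 \<noteq> - y2"
  obtains l where "ec_slope A x1 y1 x2 y2 l"
    and "Affine x1 y1 \<boxplus> Affine x2 y2 =
      Affine (l\<^sup>2 - x1 - x2) (l * (x1 - (l\<^sup>2 - x1 - x2)) - y1)"
proof -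
  have "\<exists>l. ec_slope A x1 y1 x2 y2 l"
  proof (cases "x1 = x2")
    case True
    then have "y1 = y2"
      using x_eq_imp assms by blast
    with True assms(3) have "y1 \<noteq> 0"
      by auto
    then have "ec_slope A x1 y1 x2 y2 ((3 * x1\<^sup>2 + A) / (2 * y1))"
      using True \<open>y1 = y2\<close> two_neq_0 by (simp add: ec_slope_def field_simps power2_eq_square)
    then show ?thesis ..
  next
    case False
    \<comment> \<open>The difference of the two curve equations, divided by \<open>x1 - x2\<close>,
      is the second slope equation.\<close>
    have "y1\<^sup>2 - y2\<^sup>2 = (x1 - x2) * (x1\<^sup>2 + x1 * x2 + x2\<^sup>2 + A)"
      unfolding assms(1,2)[unfolded Affine_in_iff]
      by (simp add: algebra_simps power2_eq_square power3_eq_cube)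
    then have "(y1 - y2) * (y1 + y2) = (x1 - x2) * (x1\<^sup>2 + x1 * x2 + x2\<^sup>2 + A)"
      by (simp add: algebra_simps power2_eq_square)
    then have "ec_slope A x1 y1 x2 y2 ((y1 - y2) / (x1 - x2))"
      using False by (simp add: ec_slope_def nonzero_divide_eq_eq mult.commute)
    then show ?thesis ..
  qed
  then show thesis
    using that ec_add_slope[OF _ assms(3) two_neq_0] by blast
qed

lemma add_closed [simp]:
  assumes "X \<in> ec_points A B" "Y \<in> ec_points A B"
  shows "X \<boxplus> Y \<in> ec_points A B"
proof (cases "X = Infinity \<or> Y = Infinity \<or> X = ec_neg Y")
  case True
  then show ?thesis
    using assms by (auto simp: ec_add_eq_Infinity_iff[THEN iffD2])
next
  case False
  then obtain x1 y1 x2 y2 where XY: "X = Affine x1 y1" "Y = Affine x2 y2"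
    by (metis ec_point.exhaust)
  with False have "x1 = x2 \<Longrightarrow> y1 \<noteq> - y2"
    by auto
  then show ?thesis
    using slope_exists[of x1 y1 x2 y2] assms ec_third_on_curve XY Affine_in_iff by metis
qed

lemma add_commute:
  assumes "X \<in> ec_points A B" "Y \<in> ec_points A B"
  shows "X \<boxplus> Y = Y \<boxplus> X"
proof (cases "X = Infinity \<or> Y = Infinity \<or> X = ec_neg Y")
  case True
  then show ?thesis
    using assms ec_add_eq_Infinity_iff[of A X Y] ec_add_eq_Infinity_iff[of A Y X] by auto
next
  case False
  then obtain x1 y1 x2 y2 where XY: "X = Affine x1 y1" "Y = Affine x2 y2"
    by (metis ec_point.exhaust)
  with False have ne: "x1 = x2 \<Longrightarrow> y1 \<noteq> - y2" "x2 = x1 \<Longrightarrow> y2 \<noteq> - y1"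
    by auto
  obtain l where l: "ec_slope A x1 y1 x2 y2 l"
    and 1: "X \<boxplus> Y = Affine (l\<^sup>2 - x1 - x2) (l * (x1 - (l\<^sup>2 - x1 - x2)) - y1)"
    using slope_exists[of x1 y1 x2 y2] assms ne(1) unfolding XY by blast
  have 2: "Y \<boxplus> X = Affine (l\<^sup>2 - x2 - x1) (l * (x2 - (l\<^sup>2 - x2 - x1)) - y2)"
    unfolding XY by (rule ec_add_slope[OF ec_slope_commute[OF l] ne(2) two_neq_0])
  have "y1 = y2 + l * (x1 - x2)"
    using l by (simp add: ec_slope_def algebra_simps)
  then show ?thesis
    unfolding 1 2 by (simp add: algebra_simps)
qed

lemma neg_add:
  assumes "X \<in> ec_points A B" "Y \<in> ec_points A B"
  shows "ec_neg (X \<boxplus> Y) = ec_neg X \<boxplus> ec_neg Y"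
proof (cases "X = Infinity \<or> Y = Infinity \<or> X = ec_neg Y")
  case True
  then show ?thesis
    using ec_add_eq_Infinity_iff[of A X Y] ec_add_eq_Infinity_iff[of A "ec_neg X" "ec_neg Y"] by auto
next
  case False
  then obtain x1 y1 x2 y2 where XY: "X = Affine x1 y1" "Y = Affine x2 y2"
    by (metis ec_point.exhaust)
  with False have ne: "x1 = x2 \<Longrightarrow> y1 \<noteq> - y2" "x1 = x2 \<Longrightarrow> - y1 \<noteq> - (- y2)"
    by auto
  obtain l where l: "ec_slope A x1 y1 x2 y2 l"
    and 1: "X \<boxplus> Y = Affine (l\<^sup>2 - x1 - x2) (l * (x1 - (l\<^sup>2 - x1 - x2)) - y1)"
    using slope_exists[of x1 y1 x2 y2] assms ne(1) unfolding XY by blast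
  show ?thesis
    unfolding 1 using ec_add_slope[OF ec_slope_neg[OF l] ne(2) two_neq_0] by (simp add: XY)
qed

text \<open>
  If \<open>X \<boxplus> Z = Z\<close> with \<open>X\<close> affine, then \<open>Z\<close> is a 2-torsion point at which the right-hand side of
  the curve equation has a double root.
\<close>

lemma add_eq_right_imp:
  assumes "X \<in> ec_points A B" "Z \<in> ec_points A B" "X \<boxplus> Z = Z"
  shows "X = Infinity"
proof (rule ccontr)
  assume X: "X \<noteq> Infinity"
  have Z: "Z \<noteq> Infinity" "X \<noteq> ec_neg Z"
    using assms(3) X ec_add_eq_Infinity_iff[of A X Z] by auto
  then obtain x1 y1 x2 y2 where XZ: "X = Affine x1 y1" "Z = Affine x2 y2"
    using X by (metis ec_point.exhaust)
  with Z have ne: "x1 = x2 \<Longrightarrow> y1 \<noteq> - y2"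
    by auto
  obtain l where l: "ec_slope A x1 y1 x2 y2 l"
    and 1: "X \<boxplus> Z = Affine (l\<^sup>2 - x1 - x2) (l * (x1 - (l\<^sup>2 - x1 - x2)) - y1)"
    using slope_exists[of x1 y1 x2 y2] assms ne unfolding XZ by blast
  have "Affine (l\<^sup>2 - x1 - x2) (l * (x1 - (l\<^sup>2 - x1 - x2)) - y1) = Affine x2 y2"
    using 1 assms(3) XZ(2) by metis
  then have x2: "l\<^sup>2 - x1 - x2 = x2" and y2': "l * (x1 - (l\<^sup>2 - x1 - x2)) - y1 = y2"
    by (rule ec_point.inject[THEN iffD1, THEN conjunct1],
        rule ec_point.inject[THEN iffD1, THEN conjunct2])
  with l y2'[unfolded x2] have "2 * y2 = 0"
    by (simp add: ec_slope_def algebra_simps)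
  then have y2: "y2 = 0"
    using two_neq_0 by simp
  have x1: "x1 = l\<^sup>2 - 2 * x2"
    using x2 by (simp add: algebra_simps)
  have y1: "y1 = l * (x1 - x2)"
    using l y2 by (simp add: ec_slope_def)
  have "A = l * y1 - (x1\<^sup>2 + x1 * x2 + x2\<^sup>2)"
    using l unfolding ec_slope_def y2 by (metis add.right_neutral add_diff_cancel_left')
  also have "\<dots> = - 3 * x2\<^sup>2"
    unfolding y1 x1 by algebra
  finally have A: "A = - 3 * x2\<^sup>2" .
  have "B = - (x2 ^ 3 + A * x2)"
    using assms(2) y2 by (simp add: XZ Affine_in_iff eq_neg_iff_add_eq_0 add.commute del: minus_add_distrib)
  also have "\<dots> = 2 * x2 ^ 3"
    unfolding A by algebra
  finally have B: "B = 2 * x2 ^ 3" .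
  \<comment> \<open>The cubic is now (X - \<open>x2\<close>)^2 (X + 2 \<open>x2\<close>), so its
    discriminant vanishes.\<close>
  have "4 * A ^ 3 + 27 * B\<^sup>2 = 0"
    unfolding A B by algebra
  with disc_neq_0 show False ..
qed

text \<open>The line through \<open>X \<boxplus> Z\<close> and \<open>ec_neg Z\<close> is the
  reflection of the line through \<open>X\<close> and \<open>Z\<close>, so its third point leads
  back to \<open>X\<close>. The lemma \<open>add_eq_right_imp\<close> excludes
  \<open>X \<boxplus> Z = Z\<close>, where this second sum would be \<open>Infinity\<close>.\<close>

lemma add_neg_cancel:
  assumes "X \<in> ec_points A B" "Z \<in> ec_points A B"
  shows "X \<boxplus> Z \<boxplus> ec_neg Z = X"
proof (cases "X = Infinity \<or> Z = Infinity \<or> X = ec_neg Z")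
  case True
  then show ?thesis
    using ec_add_eq_Infinity_iff[of A X Z] ec_add_eq_Infinity_iff[of A Z "ec_neg Z"] by auto
next
  case False
  then obtain x1 y1 x2 y2 where XZ: "X = Affine x1 y1" "Z = Affine x2 y2"
    by (metis ec_point.exhaust)
  with False have ne: "x1 = x2 \<Longrightarrow> y1 \<noteq> - y2"
    by auto
  obtain l where l: "ec_slope A x1 y1 x2 y2 l"
    and 1: "X \<boxplus> Z = Affine (l\<^sup>2 - x1 - x2) (l * (x1 - (l\<^sup>2 - x1 - x2)) - y1)"
    using slope_exists[of x1 y1 x2 y2] assms ne unfolding XZ by blast
  define x3 y3 where x3: "x3 = l\<^sup>2 - x1 - x2" and y3: "y3 = l * (x1 - x3) - y1"
  have "X \<boxplus> Z \<noteq> Z"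
    using add_eq_right_imp assms False by blast
  then have ne': "x3 = x2 \<Longrightarrow> y3 \<noteq> - (- y2)"
    using 1 by (auto simp: XZ x3 y3)
  have l': "ec_slope A x3 y3 x2 (- y2) (- l)"
    using ec_slope_neg[OF ec_slope_third[OF l x3 y3]] by simp
  have "X \<boxplus> Z \<boxplus> ec_neg Z = Affine ((- l)\<^sup>2 - x3 - x2) ((- l) * (x3 - ((- l)\<^sup>2 - x3 - x2)) - y3)"
    using ec_add_slope[OF l' ne' two_neq_0] 1 by (simp add: XZ x3 y3)
  also have "\<dots> = X"
    by (simp add: XZ x3 y3 algebra_simps)
  finally show ?thesis .
qed

lemma add_neg_cancel':
  assumes "X \<in> ec_points A B" "Z \<in> ec_points A B"
  shows "X \<boxplus> ec_neg Z \<boxplus> Z = X"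
  using add_neg_cancel[of X "ec_neg Z"] assms by simp

lemma eq_add_iff:
  assumes "X \<in> ec_points A B" "Y \<in> ec_points A B" "Z \<in> ec_points A B"
  shows "X = Y \<boxplus> Z \<longleftrightarrow> X \<boxplus> ec_neg Z = Y"
  using assms add_neg_cancel add_neg_cancel' by metis

section \<open>Associativity, beginning with the cases where a point or a sum is infinite\<close>

lemma add_assoc_Infinity:
  assumes "X \<in> ec_points A B" "Y \<in> ec_points A B" "Z \<in> ec_points A B"
    and "X = Infinity \<or> Y = Infinity \<or> Z = Infinity \<or> X = ec_neg Y \<or> Y = ec_neg Z \<or>
      X \<boxplus> Y = ec_neg Z \<or> X = ec_neg (Y \<boxplus> Z)"
  shows "X \<boxplus> Y \<boxplus> Z = X \<boxplus> (Y \<boxplus> Z)"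
proof -
  have inf: "U = ec_neg V \<Longrightarrow> U \<boxplus> V = Infinity" for U V
    by (simp add: ec_add_eq_Infinity_iff)
  have "X \<boxplus> (Y \<boxplus> Z) = Infinity" if "X \<boxplus> Y = ec_neg Z"
  proof -
    have "Z = ec_neg X \<boxplus> ec_neg Y"
      using that neg_add assms ec_neg_neg by metis
    then have "Y \<boxplus> Z = ec_neg X"
      using add_neg_cancel'[of "ec_neg X" Y] assms by (simp add: add_commute)
    then show ?thesis
      by (simp add: ec_add_eq_Infinity_iff)
  qed
  moreover have "X \<boxplus> Y \<boxplus> Z = Infinity" if "X = ec_neg (Y \<boxplus> Z)"
  proof -
    have "X = ec_neg Z \<boxplus> ec_neg Y"
      using that neg_add assms add_commute neg_in by metis
    then have "X \<boxplus> Y = ec_neg Z"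
      using add_neg_cancel'[of "ec_neg Z" Y] assms by simp
    then show ?thesis
      by (simp add: ec_add_eq_Infinity_iff)
  qed
  moreover have "X \<boxplus> (Y \<boxplus> Z) = Z" if "X = ec_neg Y"
    using that add_neg_cancel[of Z Y] assms by (simp add: add_commute)
  moreover have "X \<boxplus> Y \<boxplus> Z = X" if "Y = ec_neg Z"
    using that add_neg_cancel'[of X Z] assms by simp
  ultimately show ?thesis
    using assms(4) inf by auto
qed

lemma add_assoc_generic:
  assumes E: "X \<in> ec_points A B" "Y \<in> ec_points A B" "Z \<in> ec_points A B"
    and "X \<boxplus> Y \<noteq> Z" "X \<noteq> Y \<boxplus> Z"
  shows "X \<boxplus> Y \<boxplus> Z = X \<boxplus> (Y \<boxplus> Z)"
proof (cases "X = Infinity \<or> Y = Infinity \<or> Z = Infinity \<or> X = ec_neg Y \<or> Y = ec_neg Z \<or>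
      X \<boxplus> Y = ec_neg Z \<or> X = ec_neg (Y \<boxplus> Z)")
  case True
  then show ?thesis
    by (rule add_assoc_Infinity[OF E])
next
  case False
  then obtain x1 y1 x2 y2 x3 y3 where
    XYZ: "X = Affine x1 y1" "Y = Affine x2 y2" "Z = Affine x3 y3"
    by (metis ec_point.exhaust)
  with False have ne: "x1 = x2 \<Longrightarrow> y1 \<noteq> - y2" "x2 = x3 \<Longrightarrow> y2 \<noteq> - y3"
    by auto
  obtain l where l: "ec_slope A x1 y1 x2 y2 l"
    and XY: "X \<boxplus> Y = Affine (l\<^sup>2 - x1 - x2) (l * (x1 - (l\<^sup>2 - x1 - x2)) - y1)"
    using slope_exists[of x1 y1 x2 y2] E ne unfolding XYZ by blast
  obtain m where m: "ec_slope A x2 y2 x3 y3 m"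
    and YZ: "Y \<boxplus> Z = Affine (m\<^sup>2 - x2 - x3) (m * (x2 - (m\<^sup>2 - x2 - x3)) - y2)"
    using slope_exists[of x2 y2 x3 y3] E ne unfolding XYZ by blast
  define x4 y4 where x4: "x4 = l\<^sup>2 - x1 - x2" and y4: "y4 = l * (x1 - x4) - y1"
  define x5 y5 where x5: "x5 = m\<^sup>2 - x2 - x3" and y5: "y5 = m * (x2 - x5) - y2"
  have XY: "X \<boxplus> Y = Affine x4 y4" and YZ: "Y \<boxplus> Z = Affine x5 y5"
    unfolding XY YZ x4 y4 x5 y5 by simp_all
  have E': "Affine x4 y4 \<in> ec_points A B" "Affine x5 y5 \<in> ec_points A B"
    using E by (simp_all flip: XY YZ)
  \<comment> \<open>Equal abscissas would make the two points equal or opposite, and both are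
    excluded. So the outer additions use proper chords, as \<open>ec_slope_cocycle\<close>
    demands.\<close>
  have x43: "x4 \<noteq> x3"
    using x_eq_imp[of x3 y4 y3] E(3) E'(1) assms(4) False XY XYZ(3) ec_neg.simps(2) by metis
  have x15: "x1 \<noteq> x5"
    using x_eq_imp[of x5 y1 y5] E(1) E'(2) assms(5) False YZ XYZ(1) ec_neg.simps(2) by metis
  define n where "n = (y4 - y3) / (x4 - x3)"
  define k where "k = (y1 - y5) / (x1 - x5)"
  have n: "y4 - y3 = n * (x4 - x3)" and k: "y1 - y5 = k * (x1 - x5)"
    using x43 x15 by (simp_all add: n_def k_def)
  define x6 where "x6 = n\<^sup>2 - x4 - x3"
  define x7 where "x7 = k\<^sup>2 - x1 - x5"
  have n': "n = (y3 - y4) / (x3 - x4)" and k': "k = (y5 - y1) / (x5 - x1)"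
    using x43 x15 by (simp_all add: n_def k_def field_simps)
  have lhs: "X \<boxplus> Y \<boxplus> Z = Affine x6 (n * (x4 - x6) - y4)"
    unfolding XY using x43 by (simp add: XYZ Let_def x6_def n')
  have rhs: "X \<boxplus> (Y \<boxplus> Z) = Affine x7 (k * (x1 - x7) - y1)"
    unfolding YZ using x15 by (simp add: XYZ Let_def x7_def k')
  note slopes = ec_slope_cocycle[OF l m x4 y4 x5 y5 n x43 k x15]
  \<comment> \<open>The cocycle relation eliminates \<open>k\<close>; its companion
    \<open>(m - l) * (n + l) = x3 - x1\<close> then matches first the abscissas and afterwards the
    ordinates.\<close>
  have k': "k = l + n - m"
    using slopes(2) by simp
  have "n\<^sup>2 - k\<^sup>2 = x4 + x3 - x1 - x5"
    unfolding k' x4 x5 using slopes(1) by algebra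
  then have x67: "x6 = x7"
    by (simp add: x6_def x7_def algebra_simps)
  have "y1 = y2 + l * (x1 - x2)" "y3 = y2 + m * (x3 - x2)"
    using l m by (auto simp: ec_slope_def algebra_simps)
  then have "n * (x4 - x6) - y4 = k * (x1 - x6) - y1"
    unfolding k' x6_def using slopes(1) n x4 y4 by algebra
  then show ?thesis
    unfolding lhs rhs by (simp add: x67)
qed

text \<open>
  The two configurations left out above follow by subtracting a point: the generic case applies to
  \<open>S \<boxplus> S \<boxplus> ec_neg X\<close> unless \<open>S \<boxplus> S = ec_neg X\<close>, which is settled by cancellation.
\<close>

lemma double_add_double:
  assumes "X \<in> ec_points A B"
  shows "(X \<boxplus> X) \<boxplus> (X \<boxplus> X) = X \<boxplus> (X \<boxplus> (X \<boxplus> X))"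
proof -
  define D where "D = X \<boxplus> X"
  have E [simp]: "X \<in> ec_points A B" "D \<in> ec_points A B"
    using assms by (simp_all add: D_def)
  have DX: "D \<boxplus> ec_neg X = X"
    by (simp add: D_def add_neg_cancel)
  show ?thesis
  proof (cases "X = Infinity \<or> D \<boxplus> D = ec_neg X")
    case True
    then show ?thesis
    proof
      assume *: "D \<boxplus> D = ec_neg X"
      then have "D = ec_neg X \<boxplus> ec_neg D"
        using eq_add_iff[of "ec_neg X" D D] by simp
      then have "D \<boxplus> X = ec_neg D"
        by (metis E add_commute add_neg_cancel' neg_in)
      then have "X \<boxplus> D = ec_neg D"
        by (simp add: add_commute[of X D])
      also have "\<dots> = ec_neg X \<boxplus> ec_neg X"
        unfolding D_def by (simp add: neg_add)
      finally have "X \<boxplus> D = ec_neg X \<boxplus> ec_neg X" .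
      then have "X \<boxplus> (X \<boxplus> D) = ec_neg X"
        using add_neg_cancel'[of "ec_neg X" X] by (simp add: add_commute)
      then show ?thesis
        using * by (simp add: D_def)
    qed simp
  next
    case False
    have "D \<noteq> D \<boxplus> ec_neg X"
      using False add_eq_right_imp[of X X] DX by (auto simp: D_def)
    then have "D \<boxplus> D \<boxplus> ec_neg X = D \<boxplus> X"
      using add_assoc_generic[of D D "ec_neg X"] False DX by simp
    then have "D \<boxplus> D = D \<boxplus> X \<boxplus> X"
      using eq_add_iff[of "D \<boxplus> D" "D \<boxplus> X" X] by simp
    then show ?thesis
      by (simp add: D_def add_commute)
  qed
qed

lemma add_add_self:
  assumes "X \<in> ec_points A B" "Y \<in> ec_points A B"
  shows "X \<boxplus> Y \<boxplus> (X \<boxplus> Y) = X \<boxplus> (Y \<boxplus> (X \<boxplus> Y))"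
proof -
  define S where "S = X \<boxplus> Y"
  have E [simp]: "X \<in> ec_points A B" "Y \<in> ec_points A B" "S \<in> ec_points A B"
    using assms by (simp_all add: S_def)
  have SX: "S \<boxplus> ec_neg X = Y"
    by (metis S_def E(1,2) add_commute add_neg_cancel)
  show ?thesis
  proof (cases "X = Infinity \<or> S \<boxplus> S = ec_neg X")
    case True
    then show ?thesis
    proof
      assume *: "S \<boxplus> S = ec_neg X"
      \<comment> \<open>In the exceptional case \<open>X\<close> and \<open>Y\<close> are both
        expressed through \<open>S\<close>, so the claim reduces to \<open>double_add_double\<close>
        for \<open>S\<close>.\<close>
      have Y: "Y = S \<boxplus> (S \<boxplus> S)"
        unfolding * by (rule SX[symmetric])
      have "Y \<boxplus> S = (S \<boxplus> S) \<boxplus> (S \<boxplus> S)"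
        unfolding Y by (simp add: double_add_double add_commute)
      then have "X \<boxplus> (Y \<boxplus> S) = ec_neg X"
        unfolding * using add_neg_cancel'[of "ec_neg X" X] by (simp add: add_commute)
      then show ?thesis
        using * by (simp add: S_def)
    qed simp
  next
    case False
    have "S \<noteq> Y"
      using False add_eq_right_imp[of X Y] by (auto simp: S_def)
    then have "S \<boxplus> S \<boxplus> ec_neg X = S \<boxplus> Y"
      using add_assoc_generic[of S S "ec_neg X"] False SX by simp
    then have "S \<boxplus> S = S \<boxplus> Y \<boxplus> X"
      using eq_add_iff[of "S \<boxplus> S" "S \<boxplus> Y" X] by simp
    then show ?thesis
      by (simp add: S_def add_commute)
  qed
qed

lemma add_assoc:
  assumes E: "X \<in> ec_points A B" "Y \<in> ec_points A B" "Z \<in> ec_points A B"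
  shows "X \<boxplus> Y \<boxplus> Z = X \<boxplus> (Y \<boxplus> Z)"
proof -
  consider "X \<boxplus> Y = Z" | "X = Y \<boxplus> Z" | "X \<boxplus> Y \<noteq> Z" "X \<noteq> Y \<boxplus> Z"
    by blast
  then show ?thesis
  proof cases
    case 1
    then show ?thesis
      using add_add_self[of X Y] E by simp
  next
    case 2
    \<comment> \<open>By commutativity this is the first case read from right to left.\<close>
    have "Z \<boxplus> Y \<boxplus> (Z \<boxplus> Y) = Z \<boxplus> (Y \<boxplus> (Z \<boxplus> Y))"
      using E by (simp add: add_add_self)
    then show ?thesis
      unfolding 2 using E by (simp add: add_commute)
  next
    case 3
    then show ?thesis
      by (rule add_assoc_generic[OF E])
  qed
qed

lemma group_ec_group: "group (ec_group A B)"
proof (rule groupI)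
  fix X assume "X \<in> carrier (ec_group A B)"
  then show "\<exists>Y\<in>carrier (ec_group A B). Y \<otimes>\<^bsub>ec_group A B\<^esub> X = \<one>\<^bsub>ec_group A B\<^esub>"
    by (auto simp: ec_group_def ec_add_eq_Infinity_iff intro: bexI[of _ "ec_neg X"])
qed (auto simp: ec_group_def add_assoc)

section \<open>Doubling and the Lattes map\<close>

lemma double_Affine:
  assumes "Affine x y \<in> ec_points A B" "y \<noteq> 0"
  shows "xcoord (Affine x y \<boxplus> Affine x y) = lattes A B x"
proof -
  have y: "y ^ 2 = x ^ 3 + A * x + B"
    using assms(1) by (simp add: Affine_in_iff)
  have four: "(4::'k) \<noteq> 0"
    using two_neq_0 no_zero_divisors[of "2::'k" 2] by simp
  have ne: "y \<noteq> - y"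
    using assms(2) two_neq_0 by (metis add.inverse_neutral mult_2 mult_eq_0_iff neg_eq_iff_add_eq_0)
  \<comment> \<open>On the curve the Lattes denominator is the square of the denominator
    \<open>2 * y\<close> of the tangent slope.\<close>
  have den: "4 * x ^ 3 + 4 * A * x + 4 * B = 4 * y\<^sup>2"
    unfolding y by (simp add: algebra_simps)
  have "xcoord (Affine x y \<boxplus> Affine x y) = ((3 * x\<^sup>2 + A) / (2 * y))\<^sup>2 - 2 * x"
    using ne by (simp add: Let_def)
  also have "\<dots> = ((3 * x\<^sup>2 + A)\<^sup>2 - 8 * x * y\<^sup>2) / (4 * y\<^sup>2)"
    using assms(2) two_neq_0 four by (simp add: field_simps power2_eq_square)
  also have "(3 * x\<^sup>2 + A)\<^sup>2 - 8 * x * y\<^sup>2 = x ^ 4 - 2 * A * x\<^sup>2 - 8 * B * x + A\<^sup>2"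
    unfolding y by algebra
  finally show ?thesis
    unfolding lattes_def den .
qed

text \<open>A non-torsion point never reaches \<open>Infinity\<close> under doubling. Hence no
  iterate has ordinate 0, and the affine doubling formula applies at every stage.\<close>

lemma xcoord_pow_two_power:
  assumes "P \<in> carrier (ec_group A B)" "\<not> ec_torsion A B P"
  shows "xcoord (P [^]\<^bsub>ec_group A B\<^esub> (2 ^ n :: nat)) = (lattes A B ^^ n) (xcoord P)"
proof (induction n)
  case 0
  interpret group "ec_group A B"
    by (rule group_ec_group)
  show ?case
    using assms(1) by simp
next
  case (Suc n)
  interpret group "ec_group A B"
    by (rule group_ec_group)
  define Q where "Q = P [^]\<^bsub>ec_group A B\<^esub> (2 ^ n :: nat)"
  have Q2: "P [^]\<^bsub>ec_group A B\<^esub> (2 ^ Suc n :: nat) = Q \<boxplus> Q"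
    using nat_pow_mult[OF assms(1), of "2 ^ n" "2 ^ n"]
    by (simp add: Q_def mult_2 ec_group_def)
  have Q: "Q \<in> ec_points A B"
    using nat_pow_closed[OF assms(1)] by (simp add: Q_def ec_group_def)
  have inf: "P [^]\<^bsub>ec_group A B\<^esub> (2 ^ k :: nat) \<noteq> Infinity" for k
    using assms(2) unfolding ec_torsion_def
    by (metis ec_group_def monoid.select_convs(2) zero_less_numeral zero_less_power)
  obtain x y where xy: "Q = Affine x y"
    using inf[of n] by (cases Q) (auto simp: Q_def)
  have "y \<noteq> 0"
    using inf[of "Suc n"] unfolding Q2 xy by auto
  then have "xcoord (Q \<boxplus> Q) = lattes A B x"
    using double_Affine Q unfolding xy by blast
  then show ?case
    using Suc.IH unfolding Q2 by (simp add: xy del: ec_add.simps flip: Q_def)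
qed

end

section \<open>The valuation at infinity\<close>

text \<open>The negative of the valuation at infinity. As a relation it leaves 0 without a degree
  instead of assigning a default.\<close>

definition has_fract_degree :: "'a::field poly fract \<Rightarrow> int \<Rightarrow> bool" where
  "has_fract_degree z d \<longleftrightarrow>
     (\<exists>u v. u \<noteq> 0 \<and> v \<noteq> 0 \<and> z = Fract u v \<and> d = int (degree u) - int (degree v))"

lemma has_fract_degree_Fract_iff:
  fixes u v :: "'a::field poly"
  assumes "v \<noteq> 0"
  shows "has_fract_degree (Fract u v) d \<longleftrightarrow> u \<noteq> 0 \<and> d = int (degree u) - int (degree v)"
proof
  assume "has_fract_degree (Fract u v) d"
  then obtain u' v' where uv': "u' \<noteq> 0" "v' \<noteq> 0" and eq: "u * v' = u' * v"
    and d: "d = int (degree u') - int (degree v')"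
    using assms by (auto simp: has_fract_degree_def eq_fract)
  have u: "u \<noteq> 0"
    using assms uv' eq by auto
  then have "degree u + degree v' = degree u' + degree v"
    using arg_cong[OF eq, of degree] assms uv' by (simp add: degree_mult_eq)
  with u d show "u \<noteq> 0 \<and> d = int (degree u) - int (degree v)"
    by simp
qed (use assms in \<open>auto simp: has_fract_degree_def\<close>)

lemma has_fract_degree_exists:
  fixes z :: "'a::field poly fract"
  assumes "z \<noteq> 0"
  obtains d where "has_fract_degree z d"
proof -
  obtain u v where uv: "z = Fract u v" "v \<noteq> 0"
    by (cases z)
  with assms have "u \<noteq> 0"
    by (auto simp: fract_collapse)
  with uv that show thesis
    by (simp add: has_fract_degree_Fract_iff)
qed

lemma has_fract_degree_mult:
  assumes "has_fract_degree x d" "has_fract_degree y e"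
  shows "has_fract_degree (x * y) (d + e)"
  using assms
  by (auto simp: has_fract_degree_def[of x] has_fract_degree_def[of y]
      has_fract_degree_Fract_iff degree_mult_eq)

lemma has_fract_degree_divide:
  assumes "has_fract_degree x d" "has_fract_degree y e"
  shows "has_fract_degree (x / y) (d - e)"
  using assms
  by (auto simp: has_fract_degree_def[of x] has_fract_degree_def[of y]
      has_fract_degree_Fract_iff degree_mult_eq)

lemma has_fract_degree_power:
  assumes "has_fract_degree x d"
  shows "has_fract_degree (x ^ n) (int n * d)"
proof (induction n)
  case 0
  show ?case
    by (simp add: One_fract_def has_fract_degree_Fract_iff)
next
  case (Suc n)
  show ?case
    using has_fract_degree_mult[OF assms Suc.IH] by (simp add: algebra_simps)
qed

lemma numeral_eq_Fract: "(numeral k :: 'a::idom fract) = Fract (numeral k) 1"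
  by (metis of_nat_fract of_nat_numeral)

lemma has_fract_degree_numeral:
  assumes "(numeral k :: 'a::field poly fract) \<noteq> 0"
  shows "has_fract_degree (numeral k :: 'a poly fract) 0"
  using assms unfolding numeral_eq_Fract by (auto simp: has_fract_degree_Fract_iff fract_collapse)

text \<open>The equality case of the ultrametric inequality: with distinct degrees the leading terms
  cannot cancel.\<close>

lemma has_fract_degree_add:
  assumes "has_fract_degree x d" "has_fract_degree y e" "e < d"
  shows "has_fract_degree (x + y) d"
proof -
  obtain u v where x: "u \<noteq> 0" "v \<noteq> 0" "x = Fract u v" "d = int (degree u) - int (degree v)"
    using assms(1) by (auto simp: has_fract_degree_def)
  obtain s t where y: "s \<noteq> 0" "t \<noteq> 0" "y = Fract s t" "e = int (degree s) - int (degree t)"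
    using assms(2) by (auto simp: has_fract_degree_def)
  have less: "degree (s * v) < degree (u * t)"
    using x y assms(3) by (simp add: degree_mult_eq)
  then have "degree (u * t + s * v) = degree (u * t)"
    by (rule degree_add_eq_left)
  moreover from this less have "u * t + s * v \<noteq> 0"
    by force
  ultimately show ?thesis
    using x y by (simp add: has_fract_degree_Fract_iff degree_mult_eq)
qed

lemma has_fract_degree_diff:
  assumes "has_fract_degree x d" "has_fract_degree y e" "e < d"
  shows "has_fract_degree (x - y) d"
proof -
  have "has_fract_degree (- y) e"
    using assms(2) by (auto simp: has_fract_degree_def[of y] has_fract_degree_Fract_iff)
  from has_fract_degree_add[OF assms(1) this assms(3)] show ?thesis
    by simp
qed

section \<open>Degrees of Lattes values\<close>

lemma two_neq_0_imp_numerals: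
  assumes "(2::'k::field) \<noteq> 0"
  shows "(4::'k) \<noteq> 0" "(8::'k) \<noteq> 0"
proof -
  show "(4::'k) \<noteq> 0"
    using assms no_zero_divisors[of "2::'k" 2] by simp
  then show "(8::'k) \<noteq> 0"
    using assms no_zero_divisors[of "4::'k" 2] by simp
qed

context
  fixes A B x :: "'a::field poly fract" and d\<^sub>A d\<^sub>B d :: int
  assumes two: "(2::'a poly fract) \<noteq> 0"
    and A: "has_fract_degree A d\<^sub>A" and B: "has_fract_degree B d\<^sub>B" and x: "has_fract_degree x d"
begin

lemma lattes_terms_degree:
  "has_fract_degree (x ^ 4) (4 * d)" "has_fract_degree (2 * A * x\<^sup>2) (d\<^sub>A + 2 * d)"
  "has_fract_degree (8 * B * x) (d\<^sub>B + d)" "has_fract_degree (A\<^sup>2) (2 * d\<^sub>A)"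
  "has_fract_degree (4 * x ^ 3) (3 * d)" "has_fract_degree (4 * A * x) (d\<^sub>A + d)"
  "has_fract_degree (4 * B) d\<^sub>B"
proof -
  note numerals = has_fract_degree_numeral[OF two]
    two_neq_0_imp_numerals[OF two, THEN has_fract_degree_numeral]
  note mult = has_fract_degree_mult and pow = has_fract_degree_power
  show "has_fract_degree (x ^ 4) (4 * d)" "has_fract_degree (A\<^sup>2) (2 * d\<^sub>A)"
    using pow[OF x, of 4] pow[OF A, of 2] by simp_all
  show "has_fract_degree (2 * A * x\<^sup>2) (d\<^sub>A + 2 * d)" "has_fract_degree (8 * B * x) (d\<^sub>B + d)"
    using mult[OF mult[OF numerals(1) A] pow[OF x, of 2]] mult[OF mult[OF numerals(3) B] x]
    by simp_all
  show "has_fract_degree (4 * x ^ 3) (3 * d)" "has_fract_degree (4 * A * x) (d\<^sub>A + d)"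
    "has_fract_degree (4 * B) d\<^sub>B"
    using mult[OF numerals(2) pow[OF x, of 3]] mult[OF mult[OF numerals(2) A] x]
      mult[OF numerals(2) B]
    by simp_all
qed

text \<open>The two assumptions say exactly that \<open>x ^ 4\<close> dominates the numerator and
  \<open>4 * x ^ 3\<close> the denominator, so the degree is 4\<open>d\<close> -
  3\<open>d\<close>.\<close>

lemma has_fract_degree_lattes_large:
  assumes "d\<^sub>A < 2 * d" "d\<^sub>B < 3 * d"
  shows "has_fract_degree (lattes A B x) d"
proof -
  note add = has_fract_degree_add and diff = has_fract_degree_diff
  have num: "has_fract_degree (x ^ 4 - 2 * A * x\<^sup>2 - 8 * B * x + A\<^sup>2) (4 * d)"
    by (rule add[OF diff[OF diff[OF lattes_terms_degree(1,2)] lattes_terms_degree(3)]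
          lattes_terms_degree(4)]) (use assms in simp_all)
  have den: "has_fract_degree (4 * x ^ 3 + 4 * A * x + 4 * B) (3 * d)"
    by (rule add[OF add[OF lattes_terms_degree(5,6)] lattes_terms_degree(7)])
      (use assms in simp_all)
  show ?thesis
    using has_fract_degree_divide[OF num den] by (simp add: lattes_def)
qed

text \<open>Here \<open>x\<close> is so close to \<open>0\<close> that \<open>lattes A B x\<close> has the size of \<open>lattes A B 0 = A\<^sup>2 / (4 * B)\<close>.\<close>

lemma has_fract_degree_lattes_small:
  assumes "2 * d < d\<^sub>A" "d < 2 * d\<^sub>A - d\<^sub>B" "3 * d < d\<^sub>B" "d < d\<^sub>B - d\<^sub>A"
  shows "has_fract_degree (lattes A B x) (2 * d\<^sub>A - d\<^sub>B)"
proof -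
  note add = has_fract_degree_add and diff = has_fract_degree_diff
  \<comment> \<open>The constant term dominates here; the sum is reordered because
    \<open>has_fract_degree_add\<close> wants the dominating summand first.\<close>
  have "has_fract_degree (A\<^sup>2 - 8 * B * x - 2 * A * x\<^sup>2 + x ^ 4) (2 * d\<^sub>A)"
    by (rule add[OF diff[OF diff[OF lattes_terms_degree(4,3)] lattes_terms_degree(2)]
          lattes_terms_degree(1)]) (use assms in simp_all)
  moreover have "A\<^sup>2 - 8 * B * x - 2 * A * x\<^sup>2 + x ^ 4 = x ^ 4 - 2 * A * x\<^sup>2 - 8 * B * x + A\<^sup>2"
    by simp
  ultimately have num: "has_fract_degree (x ^ 4 - 2 * A * x\<^sup>2 - 8 * B * x + A\<^sup>2) (2 * d\<^sub>A)"
    by metis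
  have "has_fract_degree (4 * B + 4 * A * x + 4 * x ^ 3) d\<^sub>B"
    by (rule add[OF add[OF lattes_terms_degree(7,6)] lattes_terms_degree(5)])
      (use assms in simp_all)
  then have den: "has_fract_degree (4 * x ^ 3 + 4 * A * x + 4 * B) d\<^sub>B"
    by (simp add: ac_simps)
  show ?thesis
    using has_fract_degree_divide[OF num den] by (simp add: lattes_def)
qed

end

section \<open>The height of the Lattes map\<close>

lemma coprime_Fract_degree_le:
  fixes a b u v :: "'a::field poly"
  assumes "coprime a b" "b \<noteq> 0" "v \<noteq> 0" "Fract a b = Fract u v"
  shows "degree a \<le> degree u" "degree b \<le> degree v"
proof -
  have eq: "a * v = u * b"
    using assms by (simp add: eq_fract)
  have "a dvd u * b" "b dvd v * a"
    using eq dvd_triv_left[of a v] dvd_triv_right[of b u] by (simp_all add: mult.commute)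
  then have dvd: "a dvd u" "b dvd v"
    using coprime_dvd_mult_field_poly assms(1) coprime_commute by blast+
  show "degree b \<le> degree v"
    using dvd(2) assms(3) by (rule dvd_imp_degree_le)
  show "degree a \<le> degree u"
  proof (cases "u = 0")
    case True
    then show ?thesis
      using eq assms(3) by simp
  qed (use dvd(1) in \<open>rule dvd_imp_degree_le\<close>)
qed

lemma degree_monomial_le:
  fixes a b c :: "'a::field poly"
  assumes "i + j = 4" "degree c \<le> m"
  shows "degree (c * a ^ i * b ^ j) \<le> 4 * max (degree a) (degree b) + m"
proof -
  have "degree (c * a ^ i * b ^ j) \<le> degree c + degree (a ^ i) + degree (b ^ j)"
    by (intro order_trans[OF degree_mult_le] add_right_mono degree_mult_le)
  also have "\<dots> \<le> m + i * max (degree a) (degree b) + j * max (degree a) (degree b)"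
  proof (intro add_mono assms)
    show "degree (a ^ i) \<le> i * max (degree a) (degree b)"
      by (rule order_trans[OF degree_power_le]) simp
    show "degree (b ^ j) \<le> j * max (degree a) (degree b)"
      by (rule order_trans[OF degree_power_le]) simp
  qed
  also have "\<dots> = (i + j) * max (degree a) (degree b) + m"
    by (simp add: algebra_simps)
  finally show ?thesis
    using assms(1) by simp
qed

text \<open>Homogenising the Lattes map gives two quartic forms in \<open>a\<close> and
  \<open>b\<close> whose coefficients depend only on \<open>A\<close> and \<open>B\<close>, and
  passing to lowest terms cannot raise degrees. So one \<open>C\<close> serves all points.\<close>

lemma lattes_degree_bound:
  fixes A B :: "'a::field poly fract"
  obtains C where "\<And>a b a' b'. \<lbrakk>b \<noteq> 0; b' \<noteq> 0; coprime a' b'; lattes A B (Fract a b) = Fract a' b'\<rbrakk>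
    \<Longrightarrow> max (degree a') (degree b') \<le> 4 * max (degree a) (degree b) + C"
proof -
  obtain \<alpha>0 \<delta>1 where A0: "A = Fract \<alpha>0 \<delta>1" "\<delta>1 \<noteq> 0"
    by (cases A)
  obtain \<beta>0 \<delta>2 where B0: "B = Fract \<beta>0 \<delta>2" "\<delta>2 \<noteq> 0"
    by (cases B)
  define \<delta> where "\<delta> = \<delta>1 * \<delta>2"
  define \<alpha> where "\<alpha> = \<alpha>0 * \<delta>2"
  define \<beta> where "\<beta> = \<beta>0 * \<delta>1"
  have \<delta>: "\<delta> \<noteq> 0" and A: "A = Fract \<alpha> \<delta>" and B: "B = Fract \<beta> \<delta>"
    using A0 B0 by (simp_all add: \<delta>_def \<alpha>_def \<beta>_def eq_fract)
  define C where "C = Max (degree ` {\<delta>\<^sup>2, 2 * \<alpha> * \<delta>, 8 * \<beta> * \<delta>, \<alpha>\<^sup>2, 4 * \<delta>\<^sup>2, 4 * \<alpha> * \<delta>, 4 * \<beta> * \<delta>})"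
  have C: "degree c \<le> C" if "c \<in> {\<delta>\<^sup>2, 2 * \<alpha> * \<delta>, 8 * \<beta> * \<delta>, \<alpha>\<^sup>2, 4 * \<delta>\<^sup>2, 4 * \<alpha> * \<delta>, 4 * \<beta> * \<delta>}" for c
    unfolding C_def using that by (intro Max_ge) blast+
  show thesis
  proof (rule that)
    fix a b a' b' :: "'a poly"
    assume b: "b \<noteq> 0" "b' \<noteq> 0" "coprime a' b'" and eq: "lattes A B (Fract a b) = Fract a' b'"
    \<comment> \<open>\<open>N\<close> and \<open>D\<close> are the numerator and denominator of the
      Lattes map, multiplied by \<open>\<delta>\<^sup>2 * b ^ 4\<close>. The trivial powers fit each
      term to \<open>degree_monomial_le\<close>.\<close>
    define N where "N = \<delta>\<^sup>2 * a ^ 4 * b ^ 0 - (2 * \<alpha> * \<delta>) * a ^ 2 * b ^ 2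
      - (8 * \<beta> * \<delta>) * a ^ 1 * b ^ 3 + \<alpha>\<^sup>2 * a ^ 0 * b ^ 4"
    define D where "D = (4 * \<delta>\<^sup>2) * a ^ 3 * b ^ 1 + (4 * \<alpha> * \<delta>) * a ^ 1 * b ^ 3
      + (4 * \<beta> * \<delta>) * a ^ 0 * b ^ 4"
    have N: "degree N \<le> 4 * max (degree a) (degree b) + C"
      unfolding N_def by (intro degree_add_le degree_diff_le degree_monomial_le C) simp_all
    have D: "degree D \<le> 4 * max (degree a) (degree b) + C"
      unfolding D_def by (intro degree_add_le degree_monomial_le C) simp_all
    define T :: "'a poly \<Rightarrow> 'a poly fract" where "T = to_fract"
    have F: "Fract u v = T u / T v" for u v
      by (simp add: T_def Fract_conv_to_fract)
    have T: "T \<delta> \<noteq> 0" "T b \<noteq> 0"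
      using \<delta> b by (simp_all add: T_def)
    have T_pow: "T (p ^ k) = T p ^ k" for p k
      by (induction k) (simp_all add: T_def)
    have T_numeral: "T (numeral w) = numeral w" for w
      by (simp add: T_def to_fract_def numeral_eq_Fract)
    have hom: "T (p * q) = T p * T q" "T (p + q) = T p + T q" "T (p - q) = T p - T q" for p q
      by (simp_all add: T_def)
    note hom = hom T_pow T_numeral
    define X where "X = Fract a b"
    define p q where "p = T \<delta>" and "q = T b"
    have TX: "T a = X * q" "T b = q" "T \<alpha> = A * p" "T \<beta> = B * p" "T \<delta> = p"
      using T by (simp_all add: X_def A B F p_def q_def)
    have n: "T N = (X ^ 4 - 2 * A * X\<^sup>2 - 8 * B * X + A\<^sup>2) * (p\<^sup>2 * q ^ 4)"
      unfolding N_def hom TX by algebra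
    have d: "T D = (4 * X ^ 3 + 4 * A * X + 4 * B) * (p\<^sup>2 * q ^ 4)"
      unfolding D_def hom TX by algebra
    have ND: "Fract a' b' = T N / T D"
      unfolding eq[symmetric] lattes_def n d using T by (simp add: X_def p_def q_def)
    show "max (degree a') (degree b') \<le> 4 * max (degree a) (degree b) + C"
    proof (cases "D = 0")
      \<comment> \<open>Division by zero yields 0, so the lowest terms are those of 0 and both
        degrees are 0.\<close>
      case True
      then have "Fract a' b' = Fract 0 1"
        unfolding ND by (simp add: T_def fract_collapse)
      then have "degree a' = 0" "degree b' = 0"
        using coprime_Fract_degree_le[OF b(3,2), of 1 0] by simp_all
      then show ?thesis
        by simp
    next
      case False
      then have "degree a' \<le> degree N" "degree b' \<le> degree D"
        using coprime_Fract_degree_le[OF b(3,2), of D N] ND by (simp_all add: F)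
      then show ?thesis
        using N D by simp
    qed
  qed
qed

section \<open>Limits of normalised degrees\<close>

lemma convergent_quasi_4_adic:
  fixes h :: "nat \<Rightarrow> nat"
  assumes "\<And>n. h (Suc n) \<le> 4 * h n + C"
  shows "convergent (\<lambda>n. real (h n) / 4 ^ n)"
proof -
  \<comment> \<open>The constant \<open>C / 3\<close> solves c = C/4 + c/4, which makes
    \<open>f\<close> decreasing.\<close>
  define f where "f n = real (h n) / 4 ^ n + real C / 3 * (1 / 4) ^ n" for n
  have "f (Suc n) \<le> f n" for n
  proof -
    have "real (h (Suc n)) \<le> 4 * real (h n) + real C"
      using assms[of n] by (simp flip: of_nat_le_iff)
    then have "real (h (Suc n)) / 4 ^ Suc n \<le> (4 * real (h n) + real C) / 4 ^ Suc n"
      by (rule divide_right_mono) simp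
    also have "\<dots> = real (h n) / 4 ^ n + real C / 4 * (1 / 4) ^ n"
      by (simp add: power_one_over add_divide_distrib)
    finally show ?thesis
      by (simp add: f_def)
  qed
  then have "decseq f"
    by (rule decseq_SucI)
  moreover have "0 \<le> f n" for n
    by (simp add: f_def)
  ultimately have "convergent f"
    using decseq_convergent[of f 0] convergentI by metis
  moreover have "(\<lambda>n. real C / 3 * (1 / 4) ^ n) \<longlonglongrightarrow> 0"
    by (intro tendsto_mult_right_zero LIMSEQ_realpow_zero) simp_all
  ultimately have "convergent (\<lambda>n. f n - real C / 3 * (1 / 4) ^ n)"
    by (rule convergent_diff[OF _ convergentI])
  then show ?thesis
    by (simp add: f_def)
qed

text \<open>The argument gives liminf \<le> \<open>H\<close> \<le> limsup; the factors 1/2 and 2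
  enter because both limits are nonnegative. For the upper bound, a limsup below some
  \<open>r < H\<close> would make \<open>h n - u n\<close> exceed \<open>C\<close> eventually, as
  \<open>C / 4 ^ n\<close> tends to 0.\<close>

lemma half_liminf_le_le_twice_limsup:
  fixes u h :: "nat \<Rightarrow> nat"
  assumes lim: "(\<lambda>n. real (h n) / 4 ^ n) \<longlonglongrightarrow> H"
    and le: "\<And>n. u n \<le> h n"
    and freq: "\<exists>\<^sub>F n in sequentially. h n \<le> u n + C"
  shows "ereal (1/2) * liminf (\<lambda>n. ereal (real (u n) / 4 ^ n)) \<le> ereal H"
    and "ereal H \<le> 2 * limsup (\<lambda>n. ereal (real (u n) / 4 ^ n))"
proof -
  define l where "l = liminf (\<lambda>n. ereal (real (u n) / 4 ^ n))"
  define L where "L = limsup (\<lambda>n. ereal (real (u n) / 4 ^ n))"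
  have "0 \<le> l"
    unfolding l_def by (rule Liminf_bounded) simp
  have "0 \<le> L"
    unfolding L_def by (rule le_Limsup) simp_all
  have "l \<le> liminf (\<lambda>n. ereal (real (h n) / 4 ^ n))"
    unfolding l_def by (rule Liminf_mono) (simp add: le divide_right_mono)
  also have "\<dots> = ereal H"
    using lim by (intro lim_imp_Liminf) simp_all
  finally have "l \<le> ereal H" .
  moreover have "ereal (1/2) * l \<le> 1 * l"
    using \<open>0 \<le> l\<close> by (intro ereal_mult_right_mono) simp_all
  ultimately show "ereal (1/2) * l \<le> ereal H"
    by simp
  have "ereal H \<le> L"
  proof (rule ccontr)
    assume "\<not> ereal H \<le> L"
    then obtain r where r: "L < ereal r" "r < H"
      using ereal_dense2[of L "ereal H"] by (auto simp: not_le)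
    have "(\<lambda>n. real C * (1 / 4) ^ n) \<longlonglongrightarrow> 0"
      by (intro tendsto_mult_right_zero LIMSEQ_realpow_zero) simp_all
    then have "(\<lambda>n. real (h n) / 4 ^ n - real C * (1 / 4) ^ n) \<longlonglongrightarrow> H"
      using tendsto_diff[OF lim] by fastforce
    then have "\<forall>\<^sub>F n in sequentially. r < real (h n) / 4 ^ n - real C * (1 / 4) ^ n"
      using r(2) by (rule order_tendstoD)
    moreover have "\<forall>\<^sub>F n in sequentially. ereal (real (u n) / 4 ^ n) < ereal r"
      using r(1) unfolding L_def by (rule Limsup_lessD)
    ultimately have "\<forall>\<^sub>F n in sequentially. \<not> h n \<le> u n + C"
    proof eventually_elim
      case (elim n)
      then have "real (u n) / 4 ^ n < (real (h n) - real C) / 4 ^ n"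
        by (simp add: diff_divide_distrib power_one_over)
      then show ?case
        by (simp add: divide_less_cancel)
    qed
    with freq show False
      by (simp add: frequently_def)
  qed
  also have "1 * L \<le> 2 * L"
    using \<open>0 \<le> L\<close> by (intro ereal_mult_right_mono) simp_all
  finally show "ereal H \<le> 2 * L"
    by simp
qed

section \<open>The two degree comparisons along the orbit\<close>

lemma fract_deriv_0 [simp]: "fract_deriv (0 :: 'a::field poly fract) = 0"
  using fract_deriv_Fract[of "1::'a poly" 0] by (simp add: fract_collapse)

lemma two_neq_0_ratfun:
  assumes "CHAR('a::field) \<ge> 5"
  shows "(2 :: 'a poly fract) \<noteq> 0"
proof
  assume "(2 :: 'a poly fract) = 0"
  then have "(2 :: 'a poly) = 0"
    by (simp add: numeral_eq_Fract Zero_fract_def eq_fract)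
  then have "of_nat 2 = (0 :: 'a)"
    by (metis coeff_0 lead_coeff_numeral of_nat_numeral)
  then have "CHAR('a) dvd 2"
    by (simp only: of_nat_eq_0_iff_char_dvd)
  then show False
    using dvd_imp_le[of "CHAR('a)" 2] assms by simp
qed

theorem theorem4p1:
  fixes A B :: "'a::{finite,field} poly fract"
    and P :: "'a poly fract ec_point"
    and a b :: "nat \<Rightarrow> 'a poly"
  assumes "CHAR('a) \<ge> 5"
    and "4 * A ^ 3 + 27 * B\<^sup>2 \<noteq> 0"
    and "P \<in> carrier (ec_group A B)"
    and "\<not> ec_torsion A B P"
    and "\<And>n. b n \<noteq> 0"
    and "\<And>n. coprime (a n) (b n)"
    and "\<And>n. (lattes A B ^^ n) (xcoord P) = Fract (a n) (b n)"
    and "2 * A * fract_deriv B - 3 * B * fract_deriv A \<noteq> 0"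
  shows "ereal (1/2) * liminf (\<lambda>n. ereal (real (degree (a n)) / 4 ^ n))
           \<le> ereal (canonical_height A B P)
       \<and> ereal (canonical_height A B P)
           \<le> 2 * limsup (\<lambda>n. ereal (real (degree (a n)) / 4 ^ n))
       \<and> ereal (1/2) * liminf (\<lambda>n. ereal (real (degree (b n)) / 4 ^ n))
           \<le> ereal (canonical_height A B P)
       \<and> ereal (canonical_height A B P)
           \<le> 2 * limsup (\<lambda>n. ereal (real (degree (b n)) / 4 ^ n))"
proof -
  note two = two_neq_0_ratfun[OF assms(1)]
  interpret elliptic_curve A B
    by unfold_locales (use two assms(2) in auto)
  \<comment> \<open>If \<open>A\<close> or \<open>B\<close> were 0, its derivative would be 0 too,
    and both terms of the Wronskian would vanish.\<close>
  have AB: "A \<noteq> 0" "B \<noteq> 0"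
    using assms(8) by auto
  define x where "x n = (lattes A B ^^ n) (xcoord P)" for n
  define h where "h n = max (degree (a n)) (degree (b n))" for n
  have x: "x n = Fract (a n) (b n)" and x_Suc: "x (Suc n) = lattes A B (x n)" for n
    using assms(7) by (simp_all add: x_def)
  have x_degree: "int (degree (a n)) - int (degree (b n)) = d" if "has_fract_degree (x n) d" for n d
    using that assms(5) by (simp add: x has_fract_degree_Fract_iff)
  \<comment> \<open>An iterate equal to 0 has no degree in the sense of
    \<open>has_fract_degree\<close> and is handled separately through its lowest terms.\<close>
  have h0: "degree (a n) = 0 \<and> degree (b n) = 0" if "x n = 0" for n
    using coprime_Fract_degree_le[OF assms(6,5), of 1 n 0] that unfolding x
    by (simp add: fract_collapse)

  obtain C where "\<And>a b a' b'. \<lbrakk>b \<noteq> 0; b' \<noteq> 0; coprime a' b'; lattes A B (Fract a b) = Fract a' b'\<rbrakk>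
      \<Longrightarrow> max (degree a') (degree b') \<le> 4 * max (degree a) (degree b) + C"
    by (rule lattes_degree_bound[of A B]) blast
  then have "h (Suc n) \<le> 4 * h n + C" for n
    unfolding h_def using assms(5,6) x x_Suc by metis
  then have "(\<lambda>n. real (h n) / 4 ^ n) \<longlonglongrightarrow> lim (\<lambda>n. real (h n) / 4 ^ n)"
    by (intro convergent_LIMSEQ_iff[THEN iffD1] convergent_quasi_4_adic)
  also have "lim (\<lambda>n. real (h n) / 4 ^ n) = canonical_height A B P"
    using assms(5,6) unfolding canonical_height_def
    by (simp add: xcoord_pow_two_power[OF assms(3,4)] assms(7) ratfun_height_Fract h_def)
  finally have lim: "(\<lambda>n. real (h n) / 4 ^ n) \<longlonglongrightarrow> canonical_height A B P" .

  obtain d\<^sub>A where A: "has_fract_degree A d\<^sub>A"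
    using AB(1) by (rule has_fract_degree_exists)
  obtain d\<^sub>B where B: "has_fract_degree B d\<^sub>B"
    using AB(2) by (rule has_fract_degree_exists)
  \<comment> \<open>\<open>M\<close> exceeds every threshold: \<open>d > M\<close> suffices for the
    large case, \<open>d < - M\<close> for the small one, and \<open>M\<close> also bounds the
    absolute value of \<open>2 * d\<^sub>A - d\<^sub>B\<close>.\<close>
  define M where "M = 2 * \<bar>d\<^sub>A\<bar> + 2 * \<bar>d\<^sub>B\<bar>"
  have x_cases: "\<exists>d. has_fract_degree (x n) d" if "x n \<noteq> 0" for n
    by (rule has_fract_degree_exists[OF that]) blast
  have freq_a: "\<exists>\<^sub>F n in sequentially. h n \<le> degree (a n) + nat M"
    unfolding frequently_sequentially
  proof
    fix n
    show "\<exists>m\<ge>n. h m \<le> degree (a m) + nat M"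
    \<comment> \<open>Either \<open>n\<close> itself works, or \<open>x n\<close> is close enough to
      0 at infinity that \<open>Suc n\<close> does.\<close>
    proof (cases "h n \<le> degree (a n) + nat M")
      case False
      then have "x n \<noteq> 0"
        using h0[of n] by (auto simp: h_def)
      then obtain d where d: "has_fract_degree (x n) d"
        using x_cases by blast
      have "d < - M"
        using False x_degree[OF d] by (auto simp: h_def M_def)
      then have "has_fract_degree (x (Suc n)) (2 * d\<^sub>A - d\<^sub>B)"
        unfolding x_Suc by (intro has_fract_degree_lattes_small[OF two A B d]) (simp_all add: M_def)
      then have "h (Suc n) \<le> degree (a (Suc n)) + nat M"
        using x_degree[of "Suc n"] by (fastforce simp: h_def M_def)
      then show ?thesis
        using le_SucI by blast
    qed blast
  qed

  have "\<exists>D. \<forall>\<^sub>F n in sequentially. h n \<le> degree (b n) + D"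
  \<comment> \<open>A pole at infinity of order \<open>d > M\<close> keeps its order from then on,
    so \<open>nat d\<close> serves eventually. If none occurs, \<open>nat M\<close> serves for all
    \<open>n\<close>.\<close>
  proof (cases "\<exists>k d. has_fract_degree (x k) d \<and> d > M")
    case True
    then obtain k d where k: "has_fract_degree (x k) d" "d > M"
      by blast
    have "has_fract_degree (x n) d" if "n \<ge> k" for n
      using that
    proof (induction n rule: dec_induct)
      case (step n)
      then show ?case
        unfolding x_Suc using k(2)
        by (intro has_fract_degree_lattes_large[OF two A B]) (simp_all add: M_def)
    qed (rule k)
    then have "h n \<le> degree (b n) + nat d" if "n \<ge> k" for n
      using that x_degree[of n d] by (force simp: h_def)
    then show ?thesis
      unfolding eventually_sequentially by blast
  next
    case False
    have "h n \<le> degree (b n) + nat M" for n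
      using x_cases[of n] h0[of n] x_degree[of n] False by (fastforce simp: h_def)
    then show ?thesis
      by (auto intro: exI[of _ "nat M"])
  qed
  then obtain D where "\<forall>\<^sub>F n in sequentially. h n \<le> degree (b n) + D" ..
  then have freq_b: "\<exists>\<^sub>F n in sequentially. h n \<le> degree (b n) + D"
    by (intro eventually_frequently) simp_all

  show ?thesis
    by (intro conjI half_liminf_le_le_twice_limsup[OF lim _ freq_a]
        half_liminf_le_le_twice_limsup[OF lim _ freq_b]) (simp_all add: h_def)
qed

end
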